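(* Let $\mathbb{K}$ be a field of characteristic $0$ and $\lambda\in\mathbb{K}$ nonzero. Let $A$ be an associative $\mathbb{K}$-algebra and $B$ an associative $A$-bimodule. A linear map $P:B\to A$ is a relative averaging operator of weight $\lambda$ if and only if $P\in C^1(B,A)=\mathrm{Hom}(\mathbb{K}[T_1]\otimes B,A)\cong \mathrm{Hom}(B,A)$ is a Maurer-Cartan element of the differential graded Lie algebra $\big(\bigoplus_{n=1}^{\infty}C^n(B,A),\llbracket\ ,\ \rrbracket,d\big)$, i.e. $dP+\tfrac12\llbracket P,P\rrbracket=0$.
   Context: An associative $A$-bimodule is an associative algebra $B$ (product $xy$) with linear maps $A\otimes B\to B$, $(a,x)\mapsto a\cdot x$ and $B\otimes A\to B$, $(x,a)\mapsto x\cdot a$ such that for all $a,b\in A$, $x,y\in B$: $(ab)\cdot x=a\cdot(b\cdot x)$, $(a\cdot x)\cdot b=a\cdot(x\cdot b)$, $(x\cdot a)\cdot b=x\cdot(ab)$, $(xy)\cdot a=x(y\cdot a)$, $(x\cdot a)y=x(a\cdot y)$, $(a\cdot x)y=a\cdot(xy)$. A linear map $P:B\to A$ is a relative averaging operator of weight $\lambda$ if $P(x)P(y)=P(P(x)\cdot y)=P(x\cdot P(y))=\lambda P(xy)$ for all $x,y\in B$. Trees. For $n\ge1$, $T_n$ is the set of planar rooted trees with $n+1$ leaves in which every internal vertex has at least two incoming edges; $T_0=\{|\}$. Leaves are labelled $0,\dots,n$ from left to right. $d_i:T_n\to T_{n-1}$ deletes the $i$-th leaf (a vertex left with a single incoming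 edge is suppressed). For $m,n\ge1$, $1\le i\le m$ and $T\in T_{m+n-1}$: $R_0^{m;i,n}(T)\in T_m$ is obtained from $T$ by deleting the leaves $i,\dots,i+n-2$, and $R_i^{m;i,n}(T)\in T_n$ by deleting all leaves except $i-1,i,\dots,i+n-1$. $T_1$ has one element. $T_2=\{T^{\dashv},T^{\vdash},T^{\perp}\}$, where in $T^{\dashv}$ leaves 1,2 are joined at a vertex above the root vertex, in $T^{\vdash}$ leaves 0,1 are joined at a vertex above the root vertex, and $T^{\perp}$ has one vertex with three leaves. For a vector space $D$, $C^n(D,D)=\mathrm{Hom}(\mathbb{K}[T_n]\otimes D^{\otimes n},D)$. For $f\in C^m(D,D)$, $g\in C^n(D,D)$, $1\le i\le m$, $$(f\circ_ig)(T;x_1,\dots,x_{m+n-1})=f\big(R_0^{m;i,n}(T);x_1,\dots,x_{i-1},g(R_i^{m;i,n}(T);x_i,\dots,x_{i+n-1}),x_{i+n},\dots,x_{m+n-1}\big),$$ $$[f,g]=\sum_{i=1}^m(-1)^{(i-1)(n-1)}f\circ_ig-(-1)^{(m-1)(n-1)}\sum_{i=1}^n(-1)^{(i-1)(m-1)}g\circ_if.$$ Take $D=A\oplus B$; $C^n(B,A)=\mathrm{Hom}(\mathbb{K}[T_n]\otimes B^{\otimes n},A)$ is viewed inside $C^n(A\oplus B,A\oplus B)$ by extending by zero. Define $\pi_\lambda\in C^2(A\oplus B,A\oplus B)$ by $\pi_\lambda(T^{\dashv};(a,x),(b,y))=(ab,x\cdot b)$, $\pi_\lambda(T^{\vdash};(a,x),(b,y))=(ab,a\cdot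 y)$, $\pi_\lambda(T^{\perp};(a,x),(b,y))=(ab,\lambda xy)$. The bracket is $\llbracket f,g\rrbracket=(-1)^m[[\pi_\lambda,f],g]$ for $f\in C^m(B,A)$, $g\in C^n(B,A)$, and $d:C^n(B,A)\to C^{n+1}(B,A)$ is $$(df)(T;x_1,\dots,x_{n+1})=(-1)^{n-1}\sum_{i=1}^n(-1)^{i-1}f\big(d_iT;x_1,\dots,x_{i-1},\pi_\lambda(R_i^{n;i,2}(T);x_i,x_{i+1}),x_{i+2},\dots,x_{n+1}\big),$$ where $\pi_\lambda(S;x,y)$ for $x,y\in B$ equals $\lambda xy$ if $S=T^{\perp}$ and $0$ otherwise. *)

theory Defs
  imports Complex_Main "HOL-Library.Product_Plus"
begin

section \<open>Algebras, bimodules and relative averaging operators\<close>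

text \<open>
  The class \<^class>\<open>ring\<close> is that of associative, not necessarily unital, rings.  Scalar
  multiplications are explicit parameters.
\<close>

locale associative_algebra = vector_space scale
  for scale :: "'k::field \<Rightarrow> 'a::ring \<Rightarrow> 'a" +
  assumes scale_mult_left: "scale c x * y = scale c (x * y)"
    and scale_mult_right: "x * scale c y = scale c (x * y)"

locale associative_bimodule =
  A: associative_algebra sA + B: associative_algebra sB
  for sA :: "'k::field \<Rightarrow> 'a::ring \<Rightarrow> 'a"
    and sB :: "'k \<Rightarrow> 'b::ring \<Rightarrow> 'b" +
  fixes lact :: "'a \<Rightarrow> 'b \<Rightarrow> 'b"
    and ract :: "'b \<Rightarrow> 'a \<Rightarrow> 'b"
  assumes linear_lact_left: "Vector_Spaces.linear sA sB (\<lambda>a. lact a x)"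
    and linear_lact_right: "Vector_Spaces.linear sB sB (\<lambda>x. lact a x)"
    and linear_ract_left: "Vector_Spaces.linear sB sB (\<lambda>x. ract x a)"
    and linear_ract_right: "Vector_Spaces.linear sA sB (\<lambda>a. ract x a)"
    and lact_mult: "lact (a * b) x = lact a (lact b x)"
    and lact_ract: "ract (lact a x) b = lact a (ract x b)"
    and ract_mult: "ract (ract x a) b = ract x (a * b)"
    and mult_ract: "ract (x * y) a = x * ract y a"
    and ract_mult_lact: "ract x a * y = x * lact a y"
    and lact_mult_right: "lact a x * y = lact a (x * y)"

definition relative_averaging_operator ::
  "('k::field \<Rightarrow> 'a::ring \<Rightarrow> 'a) \<Rightarrow> ('k \<Rightarrow> 'b::ring \<Rightarrow> 'b) \<Rightarrow>
   ('a \<Rightarrow> 'b \<Rightarrow> 'b) \<Rightarrow> ('b \<Rightarrow> 'a \<Rightarrow> 'b) \<Rightarrow> 'k \<Rightarrow> ('b \<Rightarrow> 'a) \<Rightarrow> bool" where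
  "relative_averaging_operator sA sB lact ract lam P \<longleftrightarrow>
     Vector_Spaces.linear sB sA P \<and>
     (\<forall>x y. P x * P y = P (lact (P x) y) \<and>
            P (lact (P x) y) = P (ract x (P y)) \<and>
            P (ract x (P y)) = sA lam (P (x * y)))"

section \<open>Planar rooted trees\<close>

datatype ptree = Leaf | Node "ptree list"

fun leaves :: "ptree \<Rightarrow> nat" where
  "leaves Leaf = 1"
| "leaves (Node ts) = sum_list (map leaves ts)"

fun reduced :: "ptree \<Rightarrow> bool" where
  "reduced Leaf \<longleftrightarrow> True"
| "reduced (Node ts) \<longleftrightarrow> 2 \<le> length ts \<and> (\<forall>t\<in>set ts. reduced t)"

definition planar_trees :: "nat \<Rightarrow> ptree set" where
  "planar_trees n = {t. reduced t \<and> leaves t = n + 1}"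

text \<open>
  Deletion of a set of leaves.  In \<open>prune S k t\<close> the leaves of \<open>t\<close> carry the labels
  \<open>k, k + 1, \<dots>\<close> from left to right and those with label in \<open>S\<close> are deleted; the value is
  \<^const>\<open>None\<close> when no leaf survives.  The function \<open>graft\<close> suppresses a vertex left with
  a single incoming edge.
\<close>

fun graft :: "ptree list \<Rightarrow> ptree option" where
  "graft [] = None"
| "graft [t] = Some t"
| "graft ts = Some (Node ts)"

fun prune :: "nat set \<Rightarrow> nat \<Rightarrow> ptree \<Rightarrow> ptree option"
  and prune_list :: "nat set \<Rightarrow> nat \<Rightarrow> ptree list \<Rightarrow> ptree list" where
  "prune S k Leaf = (if k \<in> S then None else Some Leaf)"
| "prune S k (Node ts) = graft (prune_list S k ts)"
| "prune_list S k [] = []"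
| "prune_list S k (t # ts) =
     (case prune S k t of None \<Rightarrow> [] | Some t' \<Rightarrow> [t']) @ prune_list S (k + leaves t) ts"

definition delete_leaves :: "nat set \<Rightarrow> ptree \<Rightarrow> ptree" where
  "delete_leaves S t = the (prune S 0 t)"

definition face :: "nat \<Rightarrow> ptree \<Rightarrow> ptree" where
  "face i t = delete_leaves {i} t"

text \<open>
  The maps \<open>R\<^sub>0\<close> and \<open>R\<^sub>i\<close> with upper indices \<open>m; i, n\<close>, used for \<open>1 \<le> i \<le> m\<close>, \<open>1 \<le> n\<close> on
  trees in \<open>planar_trees (m + n - 1)\<close>; their values do not depend on \<open>m\<close> otherwise.
\<close>

definition R_outer :: "nat \<Rightarrow> nat \<Rightarrow> ptree \<Rightarrow> ptree" where
  "R_outer i n t = delete_leaves {i..<i + n - 1} t"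

definition R_inner :: "nat \<Rightarrow> nat \<Rightarrow> ptree \<Rightarrow> ptree" where
  "R_inner i n t = delete_leaves (- {i - 1..i + n - 1}) t"

definition tree_dashv :: ptree where
  "tree_dashv = Node [Leaf, Node [Leaf, Leaf]]"

definition tree_vdash :: ptree where
  "tree_vdash = Node [Node [Leaf, Leaf], Leaf]"

definition tree_perp :: ptree where
  "tree_perp = Node [Leaf, Leaf, Leaf]"

section \<open>Cochains and the graded Lie bracket\<close>

text \<open>
  A linear map from \<open>K[T\<^sub>n] \<otimes> V\<^sup>\<otimes>\<^sup>n\<close> to \<open>W\<close> is represented by the family of \<open>n\<close>-linear maps
  indexed by \<open>T \<in> T\<^sub>n\<close>, with the \<open>n\<close> arguments collected in a list.  Such families are
  normalised to be zero off their domain, so that equality of cochains is equality of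
  functions.
\<close>

definition cochains ::
  "('k::field \<Rightarrow> 'v::ab_group_add \<Rightarrow> 'v) \<Rightarrow> ('k \<Rightarrow> 'w::ab_group_add \<Rightarrow> 'w) \<Rightarrow> nat \<Rightarrow>
   (ptree \<Rightarrow> 'v list \<Rightarrow> 'w) set" where
  "cochains sV sW n = {f.
     (\<forall>T\<in>planar_trees n. \<forall>xs i. length xs = n \<and> i < n \<longrightarrow>
        Vector_Spaces.linear sV sW (\<lambda>v. f T (xs[i := v]))) \<and>
     (\<forall>T xs. \<not> (T \<in> planar_trees n \<and> length xs = n) \<longrightarrow> f T xs = 0)}"

definition one_cochain :: "('v \<Rightarrow> 'w::zero) \<Rightarrow> ptree \<Rightarrow> 'v list \<Rightarrow> 'w" where
  "one_cochain P T xs = (if T \<in> planar_trees 1 \<and> length xs = 1 then P (xs ! 0) else 0)"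

definition partial_comp ::
  "nat \<Rightarrow> nat \<Rightarrow> nat \<Rightarrow> (ptree \<Rightarrow> 'd list \<Rightarrow> 'd) \<Rightarrow> (ptree \<Rightarrow> 'd list \<Rightarrow> 'd) \<Rightarrow>
   ptree \<Rightarrow> 'd list \<Rightarrow> 'd::zero" where
  "partial_comp m n i f g T xs =
     (if T \<in> planar_trees (m + n - 1) \<and> length xs = m + n - 1
      then f (R_outer i n T)
             (take (i - 1) xs @ [g (R_inner i n T) (take n (drop (i - 1) xs))]
              @ drop (i + n - 1) xs)
      else 0)"

definition gbracket ::
  "('k::field \<Rightarrow> 'd::ab_group_add \<Rightarrow> 'd) \<Rightarrow> nat \<Rightarrow> nat \<Rightarrow>
   (ptree \<Rightarrow> 'd list \<Rightarrow> 'd) \<Rightarrow> (ptree \<Rightarrow> 'd list \<Rightarrow> 'd) \<Rightarrow> ptree \<Rightarrow> 'd list \<Rightarrow> 'd" where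
  "gbracket sD m n f g T xs =
     (\<Sum>i=1..m. sD ((-1) ^ ((i - 1) * (n - 1))) (partial_comp m n i f g T xs))
     - sD ((-1) ^ ((m - 1) * (n - 1)))
         (\<Sum>i=1..n. sD ((-1) ^ ((i - 1) * (m - 1))) (partial_comp n m i g f T xs))"

section \<open>The derived bracket, the differential and Maurer--Cartan elements\<close>

definition scale_sum ::
  "('k \<Rightarrow> 'a \<Rightarrow> 'a) \<Rightarrow> ('k \<Rightarrow> 'b \<Rightarrow> 'b) \<Rightarrow> 'k \<Rightarrow> 'a \<times> 'b \<Rightarrow> 'a \<times> 'b" where
  "scale_sum sA sB c u = (sA c (fst u), sB c (snd u))"

text \<open>The inclusion of \<open>C\<^sup>n(B, A)\<close> into \<open>C\<^sup>n(A \<oplus> B, A \<oplus> B)\<close>, extension by zero.\<close>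

definition extend :: "(ptree \<Rightarrow> 'b list \<Rightarrow> 'a) \<Rightarrow> ptree \<Rightarrow> ('a \<times> 'b) list \<Rightarrow> 'a \<times> 'b::zero" where
  "extend f T us = (f T (map snd us), 0)"

definition pi_cochain ::
  "('k::field \<Rightarrow> 'b::ring \<Rightarrow> 'b) \<Rightarrow> ('a::ring \<Rightarrow> 'b \<Rightarrow> 'b) \<Rightarrow> ('b \<Rightarrow> 'a \<Rightarrow> 'b) \<Rightarrow> 'k \<Rightarrow>
   ptree \<Rightarrow> ('a \<times> 'b) list \<Rightarrow> 'a \<times> 'b" where
  "pi_cochain sB lact ract lam T us =
     (case us of
        [(a, x), (b, y)] \<Rightarrow>
          if T = tree_dashv then (a * b, ract x b)
          else if T = tree_vdash then (a * b, lact a y)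
          else if T = tree_perp then (a * b, sB lam (x * y))
          else 0
      | _ \<Rightarrow> 0)"

text \<open>The restriction of \<^const>\<open>pi_cochain\<close> to arguments in \<open>B\<close>.\<close>

definition pi_B :: "('k \<Rightarrow> 'b::ring \<Rightarrow> 'b) \<Rightarrow> 'k \<Rightarrow> ptree \<Rightarrow> 'b \<Rightarrow> 'b \<Rightarrow> 'b" where
  "pi_B sB lam S x y = (if S = tree_perp then sB lam (x * y) else 0)"

text \<open>
  The bracket of \<open>f\<close> of degree \<open>m\<close> and \<open>g\<close> of degree \<open>n\<close>, as an element of
  \<open>C\<^sup>m\<^sup>+\<^sup>n(A \<oplus> B, A \<oplus> B)\<close>.
\<close>

definition derived_bracket ::
  "('k::field \<Rightarrow> 'a::ring \<Rightarrow> 'a) \<Rightarrow> ('k \<Rightarrow> 'b::ring \<Rightarrow> 'b) \<Rightarrow>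
   ('a \<Rightarrow> 'b \<Rightarrow> 'b) \<Rightarrow> ('b \<Rightarrow> 'a \<Rightarrow> 'b) \<Rightarrow> 'k \<Rightarrow> nat \<Rightarrow> nat \<Rightarrow>
   (ptree \<Rightarrow> 'b list \<Rightarrow> 'a) \<Rightarrow> (ptree \<Rightarrow> 'b list \<Rightarrow> 'a) \<Rightarrow>
   ptree \<Rightarrow> ('a \<times> 'b) list \<Rightarrow> 'a \<times> 'b" where
  "derived_bracket sA sB lact ract lam m n f g T us =
     scale_sum sA sB ((-1) ^ m)
       (gbracket (scale_sum sA sB) (m + 1) n
          (gbracket (scale_sum sA sB) 2 m (pi_cochain sB lact ract lam) (extend f))
          (extend g) T us)"

definition differential ::
  "('k::field \<Rightarrow> 'a::ring \<Rightarrow> 'a) \<Rightarrow> ('k \<Rightarrow> 'b::ring \<Rightarrow> 'b) \<Rightarrow> 'k \<Rightarrow> nat \<Rightarrow>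
   (ptree \<Rightarrow> 'b list \<Rightarrow> 'a) \<Rightarrow> ptree \<Rightarrow> 'b list \<Rightarrow> 'a" where
  "differential sA sB lam n f T xs =
     (if T \<in> planar_trees (n + 1) \<and> length xs = n + 1
      then sA ((-1) ^ (n - 1))
        (\<Sum>i=1..n. sA ((-1) ^ (i - 1))
           (f (face i T)
              (take (i - 1) xs @ [pi_B sB lam (R_inner i 2 T) (xs ! (i - 1)) (xs ! i)]
               @ drop (i + 1) xs)))
      else 0)"

text \<open>
  The Maurer--Cartan equation \<open>d f + 1/2 \<lbrakk>f, f\<rbrakk> = 0\<close> for \<open>f \<in> C\<^sup>1(B, A)\<close>, read in
  \<open>C\<^sup>2(A \<oplus> B, A \<oplus> B)\<close>.
\<close>

definition maurer_cartan_element ::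
  "('k::field_char_0 \<Rightarrow> 'a::ring \<Rightarrow> 'a) \<Rightarrow> ('k \<Rightarrow> 'b::ring \<Rightarrow> 'b) \<Rightarrow>
   ('a \<Rightarrow> 'b \<Rightarrow> 'b) \<Rightarrow> ('b \<Rightarrow> 'a \<Rightarrow> 'b) \<Rightarrow> 'k \<Rightarrow>
   (ptree \<Rightarrow> 'b list \<Rightarrow> 'a) \<Rightarrow> bool" where
  "maurer_cartan_element sA sB lact ract lam f \<longleftrightarrow>
     f \<in> cochains sB sA 1 \<and>
     (\<forall>T us. extend (differential sA sB lam 1 f) T us
        + scale_sum sA sB (1 / 2) (derived_bracket sA sB lact ract lam 1 1 f f T us) = 0)"

end

theory Submission
  imports Defs
begin

text \<open>
  Write \<open>F\<close> for the extension of \<open>P\<close> to \<open>A \<oplus> B\<close>.  Since \<open>F \<circ> F = 0\<close>, expanding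
  \<open>-[[\<pi>, F], F]\<close> gives \<open>2 (F \<pi>(F u, v) + F \<pi>(u, F v) - \<pi>(F u, F v))\<close>.  On the trees
  \<open>\<stileturn>\<close> and \<open>\<turnstile>\<close> the differential vanishes and only one of the first two terms survives,
  leaving \<open>P (x \<cdot> P y) = P x P y\<close> and \<open>P (P x \<cdot> y) = P x P y\<close>.  On \<open>\<bottom>\<close> both of them vanish
  and the differential contributes \<open>\<lambda> P (x y)\<close>.
\<close>

lemma leaves_pos: "reduced t \<Longrightarrow> 0 < leaves t"
proof (induction t)
  case (Node ts)
  then obtain t ts' where "ts = t # ts'" by (cases ts) auto
  with Node show ?case by auto
qed simp

text \<open>Every branch carries at least one leaf. This bounds the number of branches at the root
  and turns the enumeration of small trees into a finite case split.\<close>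

lemma length_le_sum_leaves:
  "(\<forall>t\<in>set ts. reduced t) \<Longrightarrow> length ts \<le> sum_list (map leaves ts)"
proof (induction ts)
  case (Cons t ts)
  then show ?case using leaves_pos[of t] by simp
qed simp

lemma leaves_Node_ge_2: "reduced (Node ts) \<Longrightarrow> 2 \<le> leaves (Node ts)"
  using length_le_sum_leaves[of ts] by simp

lemma reduced_leaves_1:
  assumes "reduced t" "leaves t = 1"
  shows "t = Leaf"
proof (cases t)
  case (Node ts)
  then show ?thesis using assms leaves_Node_ge_2[of ts] by simp
qed

lemma list_length_2E:
  assumes "length xs = 2"
  obtains x y where "xs = [x, y]"
  using assms by (metis length_0_conv length_Suc_conv numeral_2_eq_2)

lemma list_length_3E:
  assumes "length xs = 3"
  obtains x y z where "xs = [x, y, z]"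
  using assms by (metis length_0_conv length_Suc_conv numeral_3_eq_3)

lemma planar_trees_1: "planar_trees 1 = {Node [Leaf, Leaf]}"
proof -
  have "t = Node [Leaf, Leaf]" if "t \<in> planar_trees 1" for t
  proof (cases t)
    case (Node ts)
    with that have ts: "2 \<le> length ts" "\<forall>t\<in>set ts. reduced t" "sum_list (map leaves ts) = 2"
      by (auto simp: planar_trees_def)
    with length_le_sum_leaves[of ts] have "length ts = 2" by simp
    then obtain t1 t2 where [simp]: "ts = [t1, t2]" by (rule list_length_2E)
    have "leaves t1 = 1" "leaves t2 = 1"
      using ts leaves_pos[of t1] leaves_pos[of t2] by auto
    with ts have "t1 = Leaf" "t2 = Leaf" using reduced_leaves_1 by simp_all
    then show ?thesis using Node by simp
  qed (use that in \<open>simp add: planar_trees_def\<close>)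
  then show ?thesis by (auto simp: planar_trees_def)
qed

lemma reduced_leaves_2:
  assumes "reduced t" "leaves t = 2"
  shows "t = Node [Leaf, Leaf]"
proof -
  from assms have "t \<in> planar_trees 1" by (simp add: planar_trees_def)
  then show ?thesis unfolding planar_trees_1 by simp
qed

lemma planar_trees_2: "planar_trees 2 = {tree_dashv, tree_vdash, tree_perp}"
proof -
  have "t \<in> {tree_dashv, tree_vdash, tree_perp}" if "t \<in> planar_trees 2" for t
  proof (cases t)
    case (Node ts)
    with that have ts: "2 \<le> length ts" "\<forall>t\<in>set ts. reduced t" "sum_list (map leaves ts) = 3"
      by (auto simp: planar_trees_def)
    \<comment> \<open>Two branches share three leaves as 1 + 2 or 2 + 1, giving
      \<open>tree_dashv\<close> and \<open>tree_vdash\<close>; three branches must all be leaves,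
      giving \<open>tree_perp\<close>.\<close>
    with length_le_sum_leaves[of ts] consider "length ts = 2" | "length ts = 3" by linarith
    then show ?thesis
    proof cases
      case 1
      then obtain t1 t2 where [simp]: "ts = [t1, t2]" by (rule list_length_2E)
      have "leaves t1 = 1 \<and> leaves t2 = 2 \<or> leaves t1 = 2 \<and> leaves t2 = 1"
        using ts leaves_pos[of t1] leaves_pos[of t2] by auto
      then have "t1 = Leaf \<and> t2 = Node [Leaf, Leaf] \<or> t1 = Node [Leaf, Leaf] \<and> t2 = Leaf"
        using ts reduced_leaves_1 reduced_leaves_2 by (elim disjE) simp_all
      then show ?thesis using Node by (auto simp: tree_dashv_def tree_vdash_def)
    next
      case 2
      then obtain t1 t2 t3 where [simp]: "ts = [t1, t2, t3]" by (rule list_length_3E)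
      have "leaves t1 = 1" "leaves t2 = 1" "leaves t3 = 1"
        using ts leaves_pos[of t1] leaves_pos[of t2] leaves_pos[of t3] by auto
      with ts have "t1 = Leaf" "t2 = Leaf" "t3 = Leaf" using reduced_leaves_1 by simp_all
      then show ?thesis using Node by (simp add: tree_perp_def)
    qed
  qed (use that in \<open>simp add: planar_trees_def\<close>)
  then show ?thesis
    by (auto simp: planar_trees_def tree_dashv_def tree_vdash_def tree_perp_def)
qed

lemma tree_neqs [simp]:
  "tree_dashv \<noteq> tree_vdash" "tree_dashv \<noteq> tree_perp" "tree_vdash \<noteq> tree_perp"
  "tree_vdash \<noteq> tree_dashv" "tree_perp \<noteq> tree_dashv" "tree_perp \<noteq> tree_vdash"
  by (simp_all add: tree_dashv_def tree_vdash_def tree_perp_def)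

text \<open>The range \<open>{i..<i}\<close> is empty, and \<open>R_inner 1 2\<close> keeps the
  labels 0 to 2, that is, all leaves. The other deletions keep exactly two leaves, hence yield the
  only tree of \<open>planar_trees 1\<close>.\<close>

lemma R_planar_trees_2:
  assumes "T \<in> planar_trees 2"
  shows "R_outer i 1 T = T" "R_inner 1 1 T = Node [Leaf, Leaf]"
    "R_inner 2 1 T = Node [Leaf, Leaf]" "R_outer 1 2 T = Node [Leaf, Leaf]"
    "R_inner 1 2 T = T" "face 1 T = Node [Leaf, Leaf]"
  using assms
  by (auto simp: planar_trees_2 R_outer_def R_inner_def face_def delete_leaves_def
      tree_dashv_def tree_vdash_def tree_perp_def)

text \<open>Every sign exponent has a zero factor in these degrees. Both brackets nested in
  \<open>derived_bracket\<close> have degrees 2 and 1 when \<open>m = n = 1\<close>, so the formula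
  serves twice.\<close>

lemma gbracket_2_1:
  assumes "vector_space sD" "T \<in> planar_trees 2"
  shows "gbracket sD 2 1 f g T [u, v] =
    f T [g (Node [Leaf, Leaf]) [u], v] + f T [u, g (Node [Leaf, Leaf]) [v]]
      - g (Node [Leaf, Leaf]) [f T [u, v]]"
proof -
  interpret vector_space sD by fact
  have "{1..2::nat} = {1, 2}" by auto
  then show ?thesis
    using assms(2) R_planar_trees_2[OF assms(2)]
    by (simp add: gbracket_def partial_comp_def numeral_2_eq_2)
qed

text \<open>Needed because \<open>maurer_cartan_element\<close> quantifies over all trees and lists,
  also those outside degree 2.\<close>

lemma gbracket_2_1_eq_0:
  assumes "vector_space sD" "\<not> (T \<in> planar_trees 2 \<and> length us = 2)"
  shows "gbracket sD 2 1 f g T us = 0"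
proof -
  interpret vector_space sD by fact
  show ?thesis using assms(2) by (auto simp: gbracket_def partial_comp_def numeral_2_eq_2)
qed

lemma vector_space_scale_sum:
  assumes "vector_space sA" "vector_space sB"
  shows "vector_space (scale_sum sA sB)"
proof -
  interpret A: vector_space sA by fact
  interpret B: vector_space sB by fact
  show ?thesis
    by unfold_locales
      (simp_all add: scale_sum_def A.scale_left_distrib A.scale_right_distrib
        B.scale_left_distrib B.scale_right_distrib)
qed

lemma one_cochain_in_cochains:
  assumes "Vector_Spaces.linear sB sA P"
  shows "one_cochain P \<in> cochains sB sA 1"
  using assms by (auto simp: cochains_def one_cochain_def)

lemma extend_one_cochain [simp]:
  "extend (one_cochain P) (Node [Leaf, Leaf]) [u] = (P (snd u), 0)"
  by (simp add: extend_def one_cochain_def planar_trees_1 flip: One_nat_def)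

context associative_bimodule
begin

text \<open>Kills the terms where an action meets the zero B-component of a value of
  \<open>extend (one_cochain P)\<close>, or the zero pair left by applying that map twice.\<close>

lemma lact_zero [simp]: "lact 0 x = 0" "lact a 0 = 0"
  using linear_lact_left linear_lact_right
  by (metis Vector_Spaces.linear_def module_hom.zero linear_iff_module_hom)+

lemma ract_zero [simp]: "ract 0 a = 0" "ract x 0 = 0"
  using linear_ract_left linear_ract_right
  by (metis Vector_Spaces.linear_def module_hom.zero linear_iff_module_hom)+

lemma pi_cochain_simps [simp]:
  "pi_cochain sB lact ract lam tree_dashv [u, v] = (fst u * fst v, ract (snd u) (fst v))"
  "pi_cochain sB lact ract lam tree_vdash [u, v] = (fst u * fst v, lact (fst u) (snd v))"
  "pi_cochain sB lact ract lam tree_perp [u, v] = (fst u * fst v, sB lam (snd u * snd v))"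
  by (simp_all add: pi_cochain_def case_prod_beta)

lemma derived_bracket_one_cochain:
  assumes "Vector_Spaces.linear sB sA P" "T \<in> planar_trees 2"
  shows "derived_bracket sA sB lact ract lam 1 1 (one_cochain P) (one_cochain P) T [u, v] =
    scale_sum sA sB 2
      (P (if T = tree_dashv then ract (snd u) (P (snd v))
          else if T = tree_vdash then lact (P (snd u)) (snd v) else 0)
        - P (snd u) * P (snd v), 0)"
proof -
  interpret P: Vector_Spaces.linear sB sA P by fact
  have vs: "vector_space (scale_sum sA sB)"
    by (intro vector_space_scale_sum A.vector_space_axioms B.vector_space_axioms)
  \<comment> \<open>Each surviving term occurs twice in the double bracket.\<close>
  have two: "sA 2 a = a + a" for a
    using A.scale_left_distrib[of 1 1 a] by simp
  show ?thesis
    using assms(2)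
    \<comment> \<open>\<open>one_add_one\<close> brings the outer degree \<open>1 + 1\<close> into
      the form 2 that \<open>gbracket_2_1\<close> expects.\<close>
    unfolding derived_bracket_def one_add_one gbracket_2_1[OF vs assms(2)]
    by (auto simp: planar_trees_2 scale_sum_def two P.diff P.neg)
qed

end

lemma maurer_cartan_one_cochain_iff:
  fixes sA :: "'k::field_char_0 \<Rightarrow> 'a::ring \<Rightarrow> 'a"
    and sB :: "'k \<Rightarrow> 'b::ring \<Rightarrow> 'b"
  assumes bimodule: "associative_bimodule sA sB lact ract"
    and P: "Vector_Spaces.linear sB sA P"
  shows "maurer_cartan_element sA sB lact ract lam (one_cochain P) \<longleftrightarrow>
    (\<forall>x y. P (ract x (P y)) = P x * P y \<and> P (lact (P x) y) = P x * P y
      \<and> sA lam (P (x * y)) = P x * P y)"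
proof -
  interpret associative_bimodule sA sB lact ract by (fact bimodule)
  interpret P: Vector_Spaces.linear sB sA P by fact
  have vs: "vector_space (scale_sum sA sB)"
    by (intro vector_space_scale_sum A.vector_space_axioms B.vector_space_axioms)
  interpret D: vector_space "scale_sum sA sB" by (fact vs)
  let ?d = "differential sA sB lam 1 (one_cochain P)"
  let ?E = "\<lambda>T us. extend ?d T us
    + scale_sum sA sB (1 / 2)
        (derived_bracket sA sB lact ract lam 1 1 (one_cochain P) (one_cochain P) T us)"
  have off: "?E T us = 0" if "\<not> (T \<in> planar_trees 2 \<and> length us = 2)" for T us
  proof -
    have "extend ?d T us = 0"
      using that by (auto simp: extend_def differential_def zero_prod_def numeral_2_eq_2)
    then show ?thesis
      unfolding derived_bracket_def one_add_one gbracket_2_1_eq_0[OF vs that]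
        D.scale_zero_right by (simp add: scale_sum_def zero_prod_def)
  qed
  \<comment> \<open>The sum has the single index 1, with trivial signs. As
    \<open>R_inner 1 2 T = T\<close>, the map \<open>pi_B\<close> sees \<open>T\<close> itself, and
    off \<open>tree_perp\<close> the value is \<open>P 0 = 0\<close>.\<close>
  have d: "?d T [x, y] = (if T = tree_perp then sA lam (P (x * y)) else 0)"
    if "T \<in> planar_trees 2" for T x y
    using that R_planar_trees_2[OF that]
    by (auto simp: differential_def pi_B_def one_cochain_def planar_trees_1 P.scale
        simp flip: One_nat_def)
  \<comment> \<open>The factors 1/2 and 2 cancel in characteristic 0. The differential contributes
    only on \<open>tree_perp\<close>, where the argument of \<open>P\<close> in the bracket is 0, so
    both fit into one case distinction.\<close>
  have on: "?E T [u, v] =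
     ((if T = tree_dashv then P (ract (snd u) (P (snd v)))
       else if T = tree_vdash then P (lact (P (snd u)) (snd v))
       else sA lam (P (snd u * snd v))) - P (snd u) * P (snd v), 0)"
    if "T \<in> planar_trees 2" for T u v
    using that
    by (subst derived_bracket_one_cochain[OF P that])
      (auto simp: extend_def d planar_trees_2 simp del: One_nat_def)
  have "(\<forall>T us. ?E T us = 0) \<longleftrightarrow> (\<forall>T\<in>planar_trees 2. \<forall>u v. ?E T [u, v] = 0)"
    using off by (metis list_length_2E)
  \<comment> \<open>Only the B-components of \<open>u\<close> and \<open>v\<close> enter, so pairs
    may be replaced by elements of \<open>'b\<close>; each tree gives one equation.\<close>
  also have "\<dots> \<longleftrightarrow> (\<forall>u v::'b. P (ract u (P v)) = P u * P v \<and> P (lact (P u) v) = P u * P v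
      \<and> sA lam (P (u * v)) = P u * P v)"
    by (auto simp: on planar_trees_2 zero_prod_def simp del: One_nat_def)
  finally show ?thesis
    using one_cochain_in_cochains[OF P] by (simp add: maurer_cartan_element_def)
qed

theorem theorem4p13:
  fixes sA :: "'k::field_char_0 \<Rightarrow> 'a::ring \<Rightarrow> 'a"
    and sB :: "'k \<Rightarrow> 'b::ring \<Rightarrow> 'b"
    and lact :: "'a \<Rightarrow> 'b \<Rightarrow> 'b"
    and ract :: "'b \<Rightarrow> 'a \<Rightarrow> 'b"
    and lam :: 'k
    and P :: "'b \<Rightarrow> 'a"
  assumes "associative_bimodule sA sB lact ract"
    and "lam \<noteq> 0"
    and "Vector_Spaces.linear sB sA P"
  shows "relative_averaging_operator sA sB lact ract lam P \<longleftrightarrow>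
         maurer_cartan_element sA sB lact ract lam (one_cochain P)"
  \<comment> \<open>The chain of averaging identities is regrouped so that each member is compared
    with \<open>P x * P y\<close>.\<close>
  using maurer_cartan_one_cochain_iff[OF assms(1,3)] assms(3)
  unfolding relative_averaging_operator_def by metis

end
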